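(* Let $G$ be a connected graph of order $n$ and size $m$. Then \[LE_\varepsilon(G)\ge 2\sqrt{m+\tfrac12\Big(E_1(G)-\tfrac1n\zeta(G)^2\Big)}.\]
   Context: $G$ is simple with vertices $v_1,\dots,v_n$. $\varepsilon_G(v)=\max_{u} d_G(u,v)$ is the eccentricity ($d_G$ = shortest-path distance); $\zeta(G)=\sum_i\varepsilon_G(v_i)$; $E_1(G)=\sum_i\varepsilon_G(v_i)^2$. Let $L_\varepsilon(G)=\varepsilon(G)-A(G)$, where $A(G)$ is the adjacency matrix and $\varepsilon(G)$ the diagonal matrix with entries $\varepsilon_G(v_i)$, with eigenvalues $\mu'_1,\dots,\mu'_n$. The eccentricity version of Laplacian energy is $LE_\varepsilon(G)=\sum_{i=1}^n|\mu'_i-\zeta(G)/n|$. *)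

theory Defs
  imports
    "Graph_Theory.Graph_Theory"
    "Jordan_Normal_Form.Char_Poly"
begin

text \<open>
  Finite simple graphs are the digraphs of the locale \<open>graph\<close>: finite, symmetric, without loops
  and without parallel arcs. An undirected edge is represented by two opposite arcs, so the size
  counts unordered pairs of ends and not arcs.
\<close>

definition graph_order :: "('a, 'b) pre_digraph \<Rightarrow> nat" where
  "graph_order G = card (verts G)"

definition graph_size :: "('a, 'b) pre_digraph \<Rightarrow> nat" where
  "graph_size G = card ((\<lambda>e. {tail G e, head G e}) ` arcs G)"

text \<open>
  With unit weights the cost of a walk is its number of arcs. In a connected graph the infimum
  is attained and finite, so the conversion from \<open>ereal\<close> is harmless.
\<close>

definition graph_dist :: "('a, 'b) pre_digraph \<Rightarrow> 'a \<Rightarrow> 'a \<Rightarrow> real" where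
  "graph_dist G u v = real_of_ereal (wf_digraph.\<mu> G (\<lambda>_. 1) u v)"

definition eccentricity :: "('a, 'b) pre_digraph \<Rightarrow> 'a \<Rightarrow> real" where
  "eccentricity G v = Max ((\<lambda>u. graph_dist G u v) ` verts G)"

definition total_eccentricity :: "('a, 'b) pre_digraph \<Rightarrow> real" where
  "total_eccentricity G = (\<Sum>v\<in>verts G. eccentricity G v)"

definition first_zagreb_eccentricity :: "('a, 'b) pre_digraph \<Rightarrow> real" where
  "first_zagreb_eccentricity G = (\<Sum>v\<in>verts G. (eccentricity G v)\<^sup>2)"

text \<open>Matrices are taken with respect to a list \<open>vs\<close> enumerating the vertices.\<close>

definition adjacency_matrix :: "('a, 'b) pre_digraph \<Rightarrow> 'a list \<Rightarrow> real mat" where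
  "adjacency_matrix G vs =
     mat (length vs) (length vs) (\<lambda>(i, j). if vs ! i \<rightarrow>\<^bsub>G\<^esub> vs ! j then 1 else 0)"

definition eccentricity_matrix :: "('a, 'b) pre_digraph \<Rightarrow> 'a list \<Rightarrow> real mat" where
  "eccentricity_matrix G vs = mat_diag (length vs) (\<lambda>i. eccentricity G (vs ! i))"

definition ecc_laplacian :: "('a, 'b) pre_digraph \<Rightarrow> 'a list \<Rightarrow> real mat" where
  "ecc_laplacian G vs = eccentricity_matrix G vs - adjacency_matrix G vs"

text \<open>
  The sum ranges over the eigenvalues with multiplicity, i.e. the multiset of roots of the
  characteristic polynomial. The matrix is real symmetric, so this polynomial splits over the
  reals and no eigenvalue is lost by taking real roots only.
\<close>

definition ecc_laplacian_energy :: "('a, 'b) pre_digraph \<Rightarrow> 'a list \<Rightarrow> real" where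
  "ecc_laplacian_energy G vs =
     (\<Sum>\<mu>\<in>#proots (char_poly (ecc_laplacian G vs)).
        \<bar>\<mu> - total_eccentricity G / real (graph_order G)\<bar>)"

end

theory Submission
  imports Defs "Jordan_Normal_Form.Schur_Decomposition"
begin

text \<open>
  The numbers \<open>\<mu> - \<zeta> / n\<close>, with \<open>\<mu>\<close> ranging over the eigenvalues of \<open>\<epsilon>(G) - A(G)\<close>, have sum 0
  because the trace is \<open>\<zeta>\<close>, and their squares add up to \<open>2 m + E\<^sub>1 - \<zeta>\<^sup>2 / n\<close>, read off
  the trace of the squared matrix. If real numbers add up to 0, none exceeds half
  of \<open>S\<close>, the sum of the absolute values, in absolute value; so the sum of their squares
  is at most \<open>S\<^sup>2 / 2\<close>.
\<close>

section \<open>Trace: cyclicity, similarity, squares of triangular matrices\<close>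

definition mat_trace :: "'a :: comm_monoid_add mat \<Rightarrow> 'a" where
  "mat_trace A = (\<Sum>i<dim_row A. A $$ (i, i))"

lemma mat_trace_mult:
  fixes A B :: "'a :: comm_semiring_0 mat"
  assumes "A \<in> carrier_mat n k" and "B \<in> carrier_mat k n"
  shows "mat_trace (A * B) = (\<Sum>i<n. \<Sum>j<k. A $$ (i, j) * B $$ (j, i))"
  using assms by (auto simp: mat_trace_def scalar_prod_def lessThan_atLeast0 intro!: sum.cong)

lemma mat_trace_mult_commute:
  fixes A B :: "'a :: comm_semiring_0 mat"
  assumes "A \<in> carrier_mat n k" and "B \<in> carrier_mat k n"
  shows "mat_trace (A * B) = mat_trace (B * A)"
  unfolding mat_trace_mult[OF assms] mat_trace_mult[OF assms(2,1)]
  by (subst sum.swap) (simp add: mult.commute)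

text \<open>By cyclicity \<open>P * B * Q\<close> has the same trace as \<open>Q * (P * B)\<close>,
  and there \<open>Q * P\<close> cancels to the identity.\<close>

lemma mat_trace_similar:
  fixes A B :: "'a :: comm_ring_1 mat"
  assumes "similar_mat A B"
  shows "mat_trace A = mat_trace B"
proof -
  obtain n P Q where carr: "A \<in> carrier_mat n n" "B \<in> carrier_mat n n"
      "P \<in> carrier_mat n n" "Q \<in> carrier_mat n n"
    and QP: "Q * P = 1\<^sub>m n" and A: "A = P * B * Q"
    using similar_matD[OF assms] by auto
  have "mat_trace A = mat_trace (Q * (P * B))"
    unfolding A using carr by (intro mat_trace_mult_commute[of _ n n]) auto
  also have "Q * (P * B) = B"
    using carr by (simp add: assoc_mult_mat[of Q n n P n B n, symmetric] QP)
  finally show ?thesis .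
qed

text \<open>For \<open>i \<noteq> j\<close> one of the entries at \<open>(i, j)\<close> and
  \<open>(j, i)\<close> lies strictly below the diagonal and vanishes, so only the squares of the
  diagonal entries survive.\<close>

lemma mat_trace_square_upper_triangular:
  fixes B :: "'a :: comm_semiring_0 mat"
  assumes B: "B \<in> carrier_mat n n" and ut: "upper_triangular B"
  shows "mat_trace (B * B) = (\<Sum>i<n. B $$ (i, i) * B $$ (i, i))"
  unfolding mat_trace_mult[OF B B]
proof (intro sum.cong refl)
  fix i assume "i \<in> {..<n}"
  then have i: "i < n" by simp
  have "B $$ (i, j) * B $$ (j, i) = 0" if "j < n" "j \<noteq> i" for j
    using that i B upper_triangularD[OF ut, of i j] upper_triangularD[OF ut, of j i]
    by (cases "i < j") auto
  then have "(\<Sum>j<n. B $$ (i, j) * B $$ (j, i)) = (\<Sum>j\<in>{i}. B $$ (i, j) * B $$ (j, i))"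
    using i by (intro sum.mono_neutral_right) auto
  then show "(\<Sum>j<n. B $$ (i, j) * B $$ (j, i)) = B $$ (i, i) * B $$ (i, i)"
    by simp
qed

section \<open>Spectrum of a real symmetric matrix\<close>

lemma proots_linear_factors: "proots (\<Prod>a\<leftarrow>as. [:- a, 1:]) = mset as"
proof (induction as)
  case (Cons a as)
  have "(\<Prod>a\<leftarrow>as. [:- a, 1:]) \<noteq> 0"
    by (auto simp: prod_list_zero_iff)
  then have "proots ([:- a, 1:] * (\<Prod>a\<leftarrow>as. [:- a, 1:])) = mset (a # as)"
    by (subst proots_mult) (simp_all add: Cons)
  then show ?case by (simp only: list.map prod_list.Cons)
qed simp

text \<open>For an eigenvector \<open>v\<close>, the Hermitian form
  \<open>(A v) \<bullet>c v\<close> is \<open>k\<close> times and also \<open>cnj k\<close> times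
  the nonzero number \<open>v \<bullet>c v\<close>; the second value comes from moving the real
  symmetric matrix to the other argument.\<close>

lemma eigenvalue_symmetric_real:
  fixes A :: "real mat" and k :: complex
  assumes A: "A \<in> carrier_mat n n" and sym: "transpose_mat A = A"
    and ev: "eigenvalue (map_mat of_real A) k"
  shows "k \<in> \<real>"
proof -
  let ?A = "map_mat complex_of_real A"
  have A': "?A \<in> carrier_mat n n" using A by simp
  obtain v where v: "v \<in> carrier_vec n" "v \<noteq> 0\<^sub>v n" and Av: "?A *\<^sub>v v = k \<cdot>\<^sub>v v"
    using ev A unfolding eigenvalue_def eigenvector_def by auto
  have "transpose_mat ?A = map_mat of_real (transpose_mat A)"
    by (intro eq_matI) auto
  then have sym': "transpose_mat ?A = ?A"
    by (simp only: sym)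
  have cv: "conjugate v \<in> carrier_vec n" using v by simp
  \<comment> \<open>The entries of \<open>?A\<close> are real, so conjugation acts on the vector
    alone.\<close>
  have "conjugate (?A *\<^sub>v v) = ?A *\<^sub>v conjugate v"
    using A v by (intro eq_vecI) (auto simp: scalar_prod_def sum_conjugate conjugate_dist_mul)
  then have Acv: "?A *\<^sub>v conjugate v = cnj k \<cdot>\<^sub>v conjugate v"
    by (simp add: Av conjugate_smult_vec)
  have "k * (v \<bullet>c v) = (?A *\<^sub>v v) \<bullet>c v"
    using v cv by (simp add: Av)
  also have "\<dots> = conjugate v \<bullet> (?A *\<^sub>v v)"
    using A' v cv by (intro comm_scalar_prod[of _ n]) auto
  also have "\<dots> = (?A *\<^sub>v conjugate v) \<bullet> v"
    using transpose_vec_mult_scalar[OF A' v(1) cv] sym' by simp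
  also have "\<dots> = cnj k * (conjugate v \<bullet> v)"
    using v cv by (simp add: Acv)
  also have "conjugate v \<bullet> v = v \<bullet>c v"
    using conjugate_vec_sprod_comm[OF v(1) v(1)] by simp
  finally have "k * (v \<bullet>c v) = cnj k * (v \<bullet>c v)" .
  moreover have "v \<bullet>c v \<noteq> 0"
    using v by simp
  ultimately have "cnj k = k" by simp
  then show ?thesis by (simp add: Reals_cnj_iff)
qed

text \<open>The polynomial splits over the complex numbers and all its roots are real. Replacing
  each root by its real part makes the factorization the image of a real one, and the embedding of
  real polynomials into complex ones is injective.\<close>

lemma char_poly_symmetric_real_splits:
  fixes A :: "real mat"
  assumes A: "A \<in> carrier_mat n n" and sym: "transpose_mat A = A"
  obtains es where "char_poly A = (\<Prod>e\<leftarrow>es. [:- e, 1:])"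
proof -
  interpret h: map_poly_inj_comm_ring_hom "of_real :: real \<Rightarrow> complex" ..
  let ?A = "map_mat complex_of_real A"
  have A': "?A \<in> carrier_mat n n" using A by simp
  obtain as where as: "char_poly ?A = (\<Prod>a\<leftarrow>as. [:- a, 1:])"
    using char_poly_factorized[OF A'] by blast
  have real: "of_real (Re a) = a" if "a \<in> set as" for a
  proof -
    have "poly (char_poly ?A) a = 0"
      unfolding as poly_prod_list using that
      by (auto simp: prod_list_zero_iff image_iff intro!: bexI[of _ a])
    then show ?thesis
      using eigenvalue_symmetric_real[OF A sym] eigenvalue_root_char_poly[OF A'] by simp
  qed
  have "map_poly of_real (char_poly A) = char_poly ?A"
    by (rule of_real_hom.char_poly_hom[OF A, symmetric])
  also have "\<dots> = (\<Prod>a\<leftarrow>as. map_poly of_real [:- Re a, 1:])"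
    unfolding as using real
    by (intro arg_cong[of _ _ prod_list] map_cong) auto
  also have "\<dots> = map_poly of_real (\<Prod>e\<leftarrow>map Re as. [:- e, 1:])"
    by (simp add: h.hom_prod_list o_def)
  finally have "char_poly A = (\<Prod>e\<leftarrow>map Re as. [:- e, 1:])"
    by simp
  then show ?thesis by (rule that)
qed

text \<open>As the characteristic polynomial splits, there is a real Schur form \<open>B\<close>:
  upper triangular, similar to \<open>A\<close>, with the roots on its diagonal, repeated by
  multiplicity. Both power sums are then traces of \<open>B\<close> and \<open>B * B\<close>, which
  similarity carries over to \<open>A\<close>.\<close>

lemma symmetric_real_spectrum_sums:
  fixes A :: "real mat"
  assumes A: "A \<in> carrier_mat n n" and sym: "transpose_mat A = A"
  shows "size (proots (char_poly A)) = n"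
    and "(\<Sum>\<mu>\<in>#proots (char_poly A). \<mu>) = mat_trace A"
    and "(\<Sum>\<mu>\<in>#proots (char_poly A). \<mu>\<^sup>2) = mat_trace (A * A)"
proof -
  obtain es where es: "char_poly A = (\<Prod>e\<leftarrow>es. [:- e, 1:])"
    using char_poly_symmetric_real_splits[OF A sym] .
  obtain B P Q where "schur_decomposition A es = (B, P, Q)"
    by (cases "schur_decomposition A es")
  from schur_decomposition[OF A es this]
  have wit: "similar_mat_wit A B P Q" and ut: "upper_triangular B" and diag: "diag_mat B = es"
    by auto
  note w = similar_mat_witD2[OF A wit]
  have roots: "proots (char_poly A) = mset (map (\<lambda>i. B $$ (i, i)) [0..<n])"
    using w(5) diag by (simp add: es proots_linear_factors diag_mat_def)
  show "size (proots (char_poly A)) = n"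
    by (simp add: roots)
  have "(\<Sum>\<mu>\<in>#proots (char_poly A). \<mu>) = mat_trace B"
    using w(5) unfolding mat_trace_def by (simp add: roots sum_unfold_sum_mset lessThan_atLeast0)
  also have "mat_trace B = mat_trace A"
    using wit by (intro mat_trace_similar[symmetric]) (auto simp: similar_mat_def)
  finally show "(\<Sum>\<mu>\<in>#proots (char_poly A). \<mu>) = mat_trace A" .
  have "(\<Sum>\<mu>\<in>#proots (char_poly A). \<mu>\<^sup>2) = mat_trace (B * B)"
    unfolding mat_trace_square_upper_triangular[OF w(5) ut]
    by (simp add: roots sum_unfold_sum_mset lessThan_atLeast0 image_mset.compositionality
        o_def power2_eq_square)
  \<comment> \<open>The same \<open>P\<close> and \<open>Q\<close> that relate \<open>A\<close> to
    \<open>B\<close> also relate their squares.\<close>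
  also have "similar_mat (A ^\<^sub>m 2) (B ^\<^sub>m 2)"
    using similar_mat_wit_pow[OF wit] by (auto simp: similar_mat_def)
  then have "mat_trace (B ^\<^sub>m 2) = mat_trace (A ^\<^sub>m 2)"
    by (rule mat_trace_similar[symmetric])
  then have "mat_trace (B * B) = mat_trace (A * A)"
    using A w(5) by (simp add: numeral_2_eq_2)
  finally show "(\<Sum>\<mu>\<in>#proots (char_poly A). \<mu>\<^sup>2) = mat_trace (A * A)" .
qed

section \<open>Inequality for real numbers with sum zero, and shifts of power sums\<close>

lemma sum_squares_le_square_sum_abs:
  fixes M :: "real multiset"
  assumes "(\<Sum>x\<in>#M. x) = 0"
  shows "2 * (\<Sum>x\<in>#M. x\<^sup>2) \<le> (\<Sum>x\<in>#M. \<bar>x\<bar>)\<^sup>2"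
proof -
  define S where "S = (\<Sum>x\<in>#M. \<bar>x\<bar>)"
  have abs_le: "\<bar>\<Sum>x\<in>#N. x\<bar> \<le> (\<Sum>x\<in>#N. \<bar>x\<bar>)" for N :: "real multiset"
    by (induction N) auto
  have "2 * \<bar>x\<bar> \<le> S" if "x \<in># M" for x
  proof -
    \<comment> \<open>The remaining elements \<open>N\<close> add up to \<open>- x\<close>, so
      \<bar>x\<bar> is at most their absolute sum, which is
      \<open>S - \<bar>x\<bar>\<close>.\<close>
    obtain N where N: "M = add_mset x N" using multi_member_split[OF \<open>x \<in># M\<close>] by blast
    then show ?thesis using assms abs_le[of N] by (simp add: S_def)
  qed
  then have "2 * x\<^sup>2 \<le> S * \<bar>x\<bar>" if "x \<in># M" for x
    using mult_right_mono[of "2 * \<bar>x\<bar>" S "\<bar>x\<bar>"] that by (simp add: power2_eq_square)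
  then have "(\<Sum>x\<in>#M. 2 * x\<^sup>2) \<le> (\<Sum>x\<in>#M. S * \<bar>x\<bar>)"
    by (rule sum_mset_mono)
  then have "2 * (\<Sum>x\<in>#M. x\<^sup>2) \<le> S * (\<Sum>x\<in>#M. \<bar>x\<bar>)"
    by (simp only: sum_mset_distrib_left)
  then show ?thesis
    by (simp only: S_def power2_eq_square)
qed

lemma sum_mset_sq_dev:
  fixes M :: "real multiset" and c :: real
  shows "(\<Sum>x\<in>#M. (x - c)\<^sup>2) = (\<Sum>x\<in>#M. x\<^sup>2) - 2 * c * (\<Sum>x\<in>#M. x) + real (size M) * c\<^sup>2"
  by (induction M) (auto simp: algebra_simps power2_eq_square)

lemma sum_mset_dev:
  fixes M :: "real multiset" and c :: real
  shows "(\<Sum>x\<in>#M. x - c) = (\<Sum>x\<in>#M. x) - real (size M) * c"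
  by (induction M) (auto simp: algebra_simps)

section \<open>Counting adjacent ordered pairs by edges\<close>

lemma (in graph) card_arcs_ends: "card (arcs_ends G) = 2 * graph_size G"
proof -
  let ?f = "\<lambda>(u, v). {u, v}"
  have img: "?f ` arcs_ends G = (\<lambda>e. {tail G e, head G e}) ` arcs G"
    by (force simp: arcs_ends_conv)
  have fin: "finite (arcs_ends G)" by (simp add: arcs_ends_def)
  have "card (arcs_ends G) = (\<Sum>p\<in>arcs_ends G. 1)" by simp
  \<comment> \<open>Group the ordered pairs by the edge they span. Symmetry puts both orientations
    into each fibre, and the absence of loops makes them distinct.\<close>
  also have "\<dots> = (\<Sum>E\<in>?f ` arcs_ends G. \<Sum>p\<in>{p \<in> arcs_ends G. ?f p = E}. 1)"
    by (rule sum.image_gen[OF fin])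
  also have "\<dots> = (\<Sum>E\<in>?f ` arcs_ends G. 2)"
  proof (intro sum.cong refl)
    fix E assume "E \<in> ?f ` arcs_ends G"
    then obtain u v where E: "E = {u, v}" and uv: "(u, v) \<in> arcs_ends G" by auto
    have "(v, u) \<in> arcs_ends G" using uv by (rule graph_symmetric)
    moreover have "u \<noteq> v" using uv no_loops by (auto simp: arcs_ends_conv)
    ultimately have "{p \<in> arcs_ends G. ?f p = E} = {(u, v), (v, u)}"
      using uv by (auto simp: E doubleton_eq_iff)
    with \<open>u \<noteq> v\<close> show "(\<Sum>p\<in>{p \<in> arcs_ends G. ?f p = E}. 1) = (2 :: nat)" by simp
  qed
  also have "\<dots> = 2 * graph_size G"
    by (simp add: graph_size_def img)
  finally show ?thesis .
qed

text \<open>Since \<open>vs\<close> lists every vertex exactly once, the index pairs run through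
  \<open>verts G \<times> verts G\<close>, and the sum counts the elements of
  \<open>arcs_ends G\<close>.\<close>

lemma (in graph) sum_adjacency:
  assumes "distinct vs" and "set vs = verts G"
  shows "(\<Sum>i<length vs. \<Sum>j<length vs. if vs ! i \<rightarrow>\<^bsub>G\<^esub> vs ! j then 1 else 0) =
    (2 * real (graph_size G))"
proof -
  have bij: "bij_betw ((!) vs) {..<length vs} (verts G)"
    using bij_betw_nth[OF assms(1) refl refl] assms(2) by simp
  have "(\<Sum>i<length vs. \<Sum>j<length vs. if vs ! i \<rightarrow>\<^bsub>G\<^esub> vs ! j then 1 else 0 :: real) =
      (\<Sum>i<length vs. \<Sum>v\<in>verts G. if vs ! i \<rightarrow>\<^bsub>G\<^esub> v then 1 else 0)"
    by (intro sum.cong refl sum.reindex_bij_betw[OF bij])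
  also have "\<dots> = (\<Sum>u\<in>verts G. \<Sum>v\<in>verts G. if u \<rightarrow>\<^bsub>G\<^esub> v then 1 else 0)"
    by (rule sum.reindex_bij_betw[OF bij])
  also have "\<dots> = (\<Sum>p\<in>verts G \<times> verts G. if p \<in> arcs_ends G then 1 else 0)"
    by (simp add: sum.cartesian_product case_prod_unfold)
  also have "\<dots> = real (card ((verts G \<times> verts G) \<inter> arcs_ends G))"
    by (simp add: sum.If_cases)
  also have "(verts G \<times> verts G) \<inter> arcs_ends G = arcs_ends G"
    by (auto simp: arcs_ends_conv)
  finally show ?thesis by (simp add: card_arcs_ends)
qed

section \<open>Traces of the eccentricity Laplacian and of its square\<close>

lemma ecc_laplacian_carrier: "ecc_laplacian G vs \<in> carrier_mat (length vs) (length vs)"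
  by (auto simp: ecc_laplacian_def eccentricity_matrix_def adjacency_matrix_def mat_diag_def)

lemma ecc_laplacian_index:
  assumes "i < length vs" and "j < length vs"
  shows "ecc_laplacian G vs $$ (i, j) =
    (if i = j then eccentricity G (vs ! j) else 0) - (if vs ! i \<rightarrow>\<^bsub>G\<^esub> vs ! j then 1 else 0)"
  using assms
  by (auto simp: ecc_laplacian_def eccentricity_matrix_def adjacency_matrix_def mat_diag_def)

lemma (in graph) not_adj_self: "\<not> v \<rightarrow>\<^bsub>G\<^esub> v"
  using no_loops by (auto simp: arcs_ends_conv)

lemma (in graph) transpose_ecc_laplacian:
  "transpose_mat (ecc_laplacian G vs) = ecc_laplacian G vs"
  using ecc_laplacian_carrier[of G vs]
  by (intro eq_matI) (auto simp: ecc_laplacian_index dest: graph_symmetric)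

lemma sum_nth_verts:
  assumes "distinct vs" and "set vs = V"
  shows "(\<Sum>i<length vs. f (vs ! i)) = sum f V"
  using sum.reindex_bij_betw[OF bij_betw_nth[OF assms(1) refl refl]] assms(2) by simp

lemma (in graph) trace_ecc_laplacian:
  assumes "distinct vs" and "set vs = verts G"
  shows "mat_trace (ecc_laplacian G vs) = total_eccentricity G"
  using ecc_laplacian_carrier[of G vs] sum_nth_verts[OF assms, of "eccentricity G"]
  by (simp add: mat_trace_def ecc_laplacian_index not_adj_self total_eccentricity_def)

lemma (in graph) trace_ecc_laplacian_square:
  assumes "distinct vs" and "set vs = verts G"
  shows "mat_trace (ecc_laplacian G vs * ecc_laplacian G vs) =
    first_zagreb_eccentricity G + 2 * real (graph_size G)"
proof -
  let ?L = "ecc_laplacian G vs" and ?k = "length vs"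
  \<comment> \<open>On the diagonal there is no adjacency term, as loops are excluded. Off the
    diagonal the two entries agree by symmetry and are 0 or -1, so their product is again the 0/1
    adjacency entry.\<close>
  have "?L $$ (i, j) * ?L $$ (j, i) = (if i = j then (eccentricity G (vs ! j))\<^sup>2 else 0) +
      (if vs ! i \<rightarrow>\<^bsub>G\<^esub> vs ! j then 1 else 0)" if "i < ?k" "j < ?k" for i j
    using that
    by (auto simp: ecc_laplacian_index not_adj_self power2_eq_square dest: graph_symmetric)
  then have "mat_trace (?L * ?L) =
      (\<Sum>i<?k. (\<Sum>j<?k. if i = j then (eccentricity G (vs ! j))\<^sup>2 else 0) +
        (\<Sum>j<?k. if vs ! i \<rightarrow>\<^bsub>G\<^esub> vs ! j then 1 else 0))"
    unfolding mat_trace_mult[OF ecc_laplacian_carrier ecc_laplacian_carrier]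
    by (simp add: sum.distrib)
  also have "\<dots> = (\<Sum>i<?k. (eccentricity G (vs ! i))\<^sup>2) + 2 * real (graph_size G)"
    unfolding sum.distrib sum_adjacency[OF assms] by simp
  finally show ?thesis
    using sum_nth_verts[OF assms, of "\<lambda>v. (eccentricity G v)\<^sup>2"]
    by (simp add: first_zagreb_eccentricity_def)
qed

section \<open>Shifting the spectrum by its mean and taking square roots\<close>

theorem theorem1:
  fixes G :: "('a, 'b) pre_digraph" and vs :: "'a list" and n m :: nat
  assumes "graph G"
    and "Digraph_Component.connected G"
    and "distinct vs" and "set vs = verts G"
    and "n = graph_order G" and "m = graph_size G"
  shows "ecc_laplacian_energy G vs \<ge>
    2 * sqrt (real m +
      1 / 2 * (first_zagreb_eccentricity G - 1 / real n * (total_eccentricity G)\<^sup>2))"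
proof -
  interpret graph G by fact
  have len: "length vs = n"
    using assms by (metis distinct_card graph_order_def)
  \<comment> \<open>Connectedness includes having a vertex, which makes the mean \<open>c\<close> a
    genuine quotient.\<close>
  have "verts G \<noteq> {}"
    using assms(2) by (auto simp: Digraph_Component.connected_def strongly_connected_def)
  then have n: "n > 0" using len assms(4) by auto
  define Z where "Z = total_eccentricity G"
  define c where "c = Z / real n"
  define M where "M = proots (char_poly (ecc_laplacian G vs))"
  define N where "N = {#\<mu> - c. \<mu> \<in># M#}"
  note spec = symmetric_real_spectrum_sums[OF ecc_laplacian_carrier transpose_ecc_laplacian,
      of vs, folded M_def]
  have size: "size M = n" and sum: "(\<Sum>\<mu>\<in>#M. \<mu>) = Z"
    and sq: "(\<Sum>\<mu>\<in>#M. \<mu>\<^sup>2) = first_zagreb_eccentricity G + 2 * real m"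
    using spec trace_ecc_laplacian trace_ecc_laplacian_square assms len by (simp_all add: Z_def)
  have zero: "(\<Sum>x\<in>#N. x) = 0"
    using n sum by (simp add: N_def sum_mset_dev size c_def)
  have "(\<Sum>x\<in>#N. x\<^sup>2) = (\<Sum>\<mu>\<in>#M. (\<mu> - c)\<^sup>2)"
    by (simp add: N_def image_mset.compositionality o_def)
  also have "\<dots> = first_zagreb_eccentricity G + 2 * real m - 2 * c * Z + real n * c\<^sup>2"
    by (simp only: sum_mset_sq_dev sum sq size)
  \<comment> \<open>With \<open>c = Z / n\<close> the cross term is
    \<open>- 2 * Z\<^sup>2 / n\<close> and the constant term adds back
    \<open>Z\<^sup>2 / n\<close>.\<close>
  also have "\<dots> = first_zagreb_eccentricity G + 2 * real m - Z\<^sup>2 / real n"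
    using n by (simp add: c_def power2_eq_square)
  finally have sq_N: "(\<Sum>x\<in>#N. x\<^sup>2) = \<dots>" .
  define K where "K = real m + 1 / 2 * (first_zagreb_eccentricity G - 1 / real n * Z\<^sup>2)"
  \<comment> \<open>The sum of squares of the shifted spectrum is \<open>2 * K\<close>; the factor 4
    is the square of the 2 in front of the root.\<close>
  have "2\<^sup>2 * K = 2 * (\<Sum>x\<in>#N. x\<^sup>2)"
    by (simp add: K_def sq_N diff_divide_distrib)
  also have "\<dots> \<le> (\<Sum>x\<in>#N. \<bar>x\<bar>)\<^sup>2"
    by (rule sum_squares_le_square_sum_abs[OF zero])
  \<comment> \<open>In HOL \<open>sqrt\<close> is monotone on all reals, so the sign of
    \<open>K\<close> raises no question here.\<close>
  finally have "sqrt (2\<^sup>2 * K) \<le> sqrt ((\<Sum>x\<in>#N. \<bar>x\<bar>)\<^sup>2)"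
    by (rule real_sqrt_le_mono)
  moreover have "sqrt (2\<^sup>2 * K) = 2 * sqrt K"
    by (subst real_sqrt_mult) simp
  moreover have "(\<Sum>x\<in>#N. \<bar>x\<bar>) \<ge> 0"
    by (induction N) auto
  ultimately have "2 * sqrt K \<le> (\<Sum>x\<in>#N. \<bar>x\<bar>)"
    by simp
  also have "\<dots> = ecc_laplacian_energy G vs"
    by (simp add: N_def M_def c_def Z_def ecc_laplacian_energy_def assms(5)
        image_mset.compositionality o_def)
  finally show ?thesis
    unfolding K_def Z_def .
qed

end
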